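(* Let $A\in\mathbb{Z}^{d\times n}$ have rank $d$ with columns lying in an affine hyperplane of $\mathbb{Q}^d$ not containing the origin, let $\beta\in\mathbb{C}^d$, and let $w\in\mathbb{R}^n$ be a generic weight vector. Let $v$ be any fake exponent of $H_A(\beta)$ with respect to $w$, with $I_0=\operatorname{nsupp}(v)=\{i_1,\ldots,i_k\}$ and $V=[n]\setminus I_0$. Let $L_1,\ldots,L_k,\ell_1,\ldots,\ell_{d-k}$ be linear forms in $\theta_V=(\theta_j)_{j\in V}$ such that $\langle A\theta\rangle$ is generated by $\theta_{i_1}-L_1(\theta_V),\ldots,\theta_{i_k}-L_k(\theta_V),\ell_1(\theta_V),\ldots,\ell_{d-k}(\theta_V)$, and regard $\ell_1,\ldots,\ell_{d-k}$ as elements of $\mathbb{C}[\operatorname{link}_v]$ via $\theta_j\mapsto x_j$. Then the quotient $$\mathbb{C}[\operatorname{link}_v]/(\ell_1,\ldots,\ell_{d-|I_0|})$$ is a finite-dimensional $\mathbb{C}$-vector space.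
   Context: Notation: $\mathbb{N}=\{0,1,2,\ldots\}$, $[n]=\{1,\ldots,n\}$. The toric ideal is $I_A=\langle\partial^u-\partial^{u'}\mid Au=Au',\ u,u'\in\mathbb{N}^n\rangle\subseteq\mathbb{C}[\partial_1,\ldots,\partial_n]$. $\operatorname{in}_w(I_A)$ is the ideal generated by the $w$-initial forms (sums of terms of maximal $w$-weight) of elements of $I_A$; "$w$ generic" means in particular that $\operatorname{in}_w(I_A)$ is a monomial ideal. Let $D=\mathbb{C}\langle x_1,\ldots,x_n,\partial_1,\ldots,\partial_n\rangle$ be the Weyl algebra and $\vartheta_j=x_j\partial_j$. $H_A(\beta)$ is the left ideal of $D$ generated by $I_A$ and the Euler operators $\sum_j a_{ij}\vartheta_j-\beta_i$. The fake indicial ideal is $(D\cdot\operatorname{in}_w(I_A)\cap\mathbb{C}[\vartheta])+\langle A\vartheta-\beta\rangle\subseteq\mathbb{C}[\vartheta]$; a zero $v\in\mathbb{C}^n$ of it is called a fake exponent of $H_A(\beta)$ with respect to $w$. $\operatorname{nsupp}(z)=\{j\in[n]\mid z_j\in\mathbb{Z}_{<0}\}$ for $z\in\mathbb{C}^n$. A standard pair of a monomial ideal $M\subseteq\mathbb{C}[\partial]$ is a pair $(a,\sigma)$, $a\in\mathbb{N}^n$, $\sigma\subseteq[n]$, such that (i) $a_i=0$ for $i\in\sigma$; (ii) $\partial^a\prod_{j\in\sigma}\partial_j^{b_j}\notin M$ for all $b_j\in\mathbb{N}$; (iii) for every $\ell\notin\sigma$ there are $b_j\in\mathbb{N}$ ($j\in\sigma\cup\{\ell\}$)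 with $\partial^a\prod_{j\in\sigma\cup\{\ell\}}\partial_j^{b_j}\in M$. $\mathcal{S}(M)$ is the set of standard pairs, and $\mathcal{S}_w(v)=\{(a,\sigma)\in\mathcal{S}(\operatorname{in}_w(I_A))\mid v_j=a_j\text{ for every }j\notin\sigma\}$. (Known criterion: $v$ is a fake exponent iff $Av=\beta$ and $\mathcal{S}_w(v)\neq\emptyset$.) $\Delta_w(v)=\{\tau\subseteq[n]\mid\tau\subseteq\sigma\text{ for some }(a,\sigma)\in\mathcal{S}_w(v)\}$, and $\operatorname{link}_v=\{\tau\in\Delta_w(v)\mid\tau\cap I_0=\emptyset,\ \tau\cup I_0\in\Delta_w(v)\}$, regarded as a simplicial complex on the vertex set $V$ (some elements of $V$ may be nonfaces). For a simplicial complex $\Delta$ on $V$, $I_\Delta=\langle\prod_{i\in\tau}x_i\mid\tau\subseteq V,\ \tau\notin\Delta\rangle$ and $\mathbb{C}[\Delta]=\mathbb{C}[x_i\mid i\in V]/I_\Delta$. $\langle A\theta\rangle=\langle\sum_j a_{ij}\theta_j\mid i=1,\ldots,d\rangle\subseteq\mathbb{C}[\theta_1,\ldots,\theta_n]$. Linear forms $L_p,\ell_q$ as in the claim exist by row reduction. *)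

theory Defs
  imports
    "HOL-Analysis.Cartesian_Space"
    "HOL-Library.Poly_Mapping"
    "HOL-Algebra.QuotRing"
    "HOL-Algebra.Embedded_Algebras"
begin

text \<open>
  The index sets $[n]$ and $[d]$ are finite types \<open>'n\<close> and \<open>'d\<close>, and an exponent vector in
  $\mathbb{N}^n$ is a finitely supported map \<open>'n \<Rightarrow>\<^sub>0 nat\<close>.  The monoid algebra below serves as
  $\mathbb{C}[\partial]$, $\mathbb{C}[\vartheta]$, $\mathbb{C}[\theta]$ and $\mathbb{C}[x]$ alike;
  the renaming $\theta_j \mapsto x_j$ is therefore the identity.
\<close>

type_synonym 'n mpol = "('n \<Rightarrow>\<^sub>0 nat) \<Rightarrow>\<^sub>0 complex"

definition cst :: "complex \<Rightarrow> 'n mpol"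
  where "cst c = Poly_Mapping.single 0 c"

definition mon :: "('n \<Rightarrow>\<^sub>0 nat) \<Rightarrow> 'n mpol"
  where "mon u = Poly_Mapping.single u 1"

definition var :: "'n \<Rightarrow> 'n mpol"
  where "var j = mon (Poly_Mapping.single j 1)"

definition vars :: "'n mpol \<Rightarrow> 'n set"
  where "vars p = (\<Union>u\<in>Poly_Mapping.keys p. Poly_Mapping.keys u)"

definition peval :: "complex ^ 'n \<Rightarrow> 'n::finite mpol \<Rightarrow> complex"
  where "peval v p = (\<Sum>u\<in>Poly_Mapping.keys p.
           Poly_Mapping.lookup p u * (\<Prod>j\<in>UNIV. (v $ j) ^ Poly_Mapping.lookup u j))"

definition pdiff :: "'n \<Rightarrow> 'n mpol \<Rightarrow> 'n mpol"
  where "pdiff j p = (\<Sum>u\<in>Poly_Mapping.keys p.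
           Poly_Mapping.single (u - Poly_Mapping.single j 1)
             (of_nat (Poly_Mapping.lookup u j) * Poly_Mapping.lookup p u))"

definition poly_ring :: "'n set \<Rightarrow> 'n mpol ring"
  where "poly_ring V =
    \<lparr>carrier = {p. vars p \<subseteq> V}, monoid.mult = (*), one = 1, zero = 0, add = (+)\<rparr>"


subsection \<open>Initial ideals and the toric ideal\<close>

definition weight :: "real ^ 'n \<Rightarrow> ('n::finite \<Rightarrow>\<^sub>0 nat) \<Rightarrow> real"
  where "weight w u = (\<Sum>j\<in>UNIV. w $ j * real (Poly_Mapping.lookup u j))"

definition initial_form :: "real ^ 'n \<Rightarrow> 'n::finite mpol \<Rightarrow> 'n mpol"
  where "initial_form w p =
    (\<Sum>u | u \<in> Poly_Mapping.keys p \<and> (\<forall>u'\<in>Poly_Mapping.keys p. weight w u' \<le> weight w u).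
       Poly_Mapping.single u (Poly_Mapping.lookup p u))"

definition initial_ideal :: "real ^ 'n \<Rightarrow> 'n::finite mpol set \<Rightarrow> 'n mpol set"
  where "initial_ideal w I = Idl\<^bsub>poly_ring UNIV\<^esub> (initial_form w ` I)"

definition monomial_ideal :: "'n mpol set \<Rightarrow> bool"
  where "monomial_ideal M \<longleftrightarrow> (\<exists>U. M = Idl\<^bsub>poly_ring UNIV\<^esub> (mon ` U))"

definition exponent_image :: "int ^ 'n ^ 'd \<Rightarrow> ('n::finite \<Rightarrow>\<^sub>0 nat) \<Rightarrow> int ^ 'd"
  where "exponent_image A u = A *v (\<chi> j. int (Poly_Mapping.lookup u j))"

definition toric_ideal :: "int ^ 'n ^ 'd \<Rightarrow> 'n::finite mpol set"
  where "toric_ideal A =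
    Idl\<^bsub>poly_ring UNIV\<^esub> {mon u - mon u' | u u'. exponent_image A u = exponent_image A u'}"

text \<open>
  Of genericity only its basic consequence is demanded: the initial ideal is monomial.  Any stricter
  notion of a generic weight implies this one.
\<close>

definition generic_weight :: "int ^ 'n ^ 'd \<Rightarrow> real ^ 'n::finite \<Rightarrow> bool"
  where "generic_weight A w \<longleftrightarrow> monomial_ideal (initial_ideal w (toric_ideal A))"

definition affine_hyperplane :: "(rat ^ 'd::finite) set \<Rightarrow> bool"
  where "affine_hyperplane H \<longleftrightarrow> (\<exists>c b. c \<noteq> 0 \<and> H = {y. (\<Sum>i\<in>UNIV. c $ i * y $ i) = b})"


subsection \<open>The Weyl algebra and fake exponents\<close>

text \<open>
  The Weyl algebra is realised as the subalgebra of
  $\mathrm{End}_{\mathbb{C}}(\mathbb{C}[x])$ generated by the multiplications by $x_j$ and the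
  derivations $\partial_j$; in characteristic 0 this representation is faithful.
\<close>

inductive_set weyl_ops :: "('n mpol \<Rightarrow> 'n mpol) set" where
  scalar: "(\<lambda>f. cst c * f) \<in> weyl_ops"
| position: "(\<lambda>f. var j * f) \<in> weyl_ops"
| derivation: "pdiff j \<in> weyl_ops"
| sum: "P \<in> weyl_ops \<Longrightarrow> Q \<in> weyl_ops \<Longrightarrow> (\<lambda>f. P f + Q f) \<in> weyl_ops"
| product: "P \<in> weyl_ops \<Longrightarrow> Q \<in> weyl_ops \<Longrightarrow> P \<circ> Q \<in> weyl_ops"

definition weyl_algebra :: "('n mpol \<Rightarrow> 'n mpol) ring"
  where "weyl_algebra =
    \<lparr>carrier = weyl_ops, monoid.mult = (\<circ>), one = id,
     zero = (\<lambda>f. 0), add = (\<lambda>P Q f. P f + Q f)\<rparr>"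

definition left_ideal_gen :: "('a, 'b) ring_scheme \<Rightarrow> 'a set \<Rightarrow> 'a set"
  where "left_ideal_gen R S =
    \<Inter>{J. additive_subgroup J R \<and> (\<forall>P\<in>carrier R. \<forall>Q\<in>J. P \<otimes>\<^bsub>R\<^esub> Q \<in> J) \<and> S \<subseteq> J}"

text \<open>
  \<open>op_subst T p\<close> is the operator $p(T_1,\ldots,T_n)$.  It is used only for the two families of
  pairwise commuting operators $\partial_j$ and $\vartheta_j = x_j\partial_j$, so the order in which
  the fold composes the factors is irrelevant.
\<close>

definition op_mon :: "('n::finite \<Rightarrow> 'n mpol \<Rightarrow> 'n mpol) \<Rightarrow> ('n \<Rightarrow>\<^sub>0 nat) \<Rightarrow> 'n mpol \<Rightarrow> 'n mpol"
  where "op_mon T u = Finite_Set.fold (\<lambda>j P. (T j ^^ Poly_Mapping.lookup u j) \<circ> P) id UNIV"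

definition op_subst :: "('n::finite \<Rightarrow> 'n mpol \<Rightarrow> 'n mpol) \<Rightarrow> 'n mpol \<Rightarrow> 'n mpol \<Rightarrow> 'n mpol"
  where "op_subst T p =
    (\<lambda>f. \<Sum>u\<in>Poly_Mapping.keys p. cst (Poly_Mapping.lookup p u) * op_mon T u f)"

definition euler_op :: "'n \<Rightarrow> 'n mpol \<Rightarrow> 'n mpol"
  where "euler_op j = (\<lambda>f. var j * pdiff j f)"

definition row_form :: "int ^ 'n ^ 'd \<Rightarrow> 'd \<Rightarrow> 'n::finite mpol"
  where "row_form A i = (\<Sum>j\<in>UNIV. cst (of_int (A $ i $ j)) * var j)"

text \<open>
  The subalgebra $\mathbb{C}[\vartheta]$ of the Weyl algebra is a polynomial ring in the
  $\vartheta_j$; its elements are represented by the polynomials \<open>f\<close> with value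
  \<open>op_subst euler_op f\<close>.
\<close>

definition fake_indicial_ideal ::
    "int ^ 'n ^ 'd \<Rightarrow> complex ^ 'd \<Rightarrow> real ^ 'n \<Rightarrow> 'n::finite mpol set"
  where "fake_indicial_ideal A \<beta> w =
    {f. op_subst euler_op f \<in>
          left_ideal_gen weyl_algebra (op_subst pdiff ` initial_ideal w (toric_ideal A))}
    <+>\<^bsub>poly_ring UNIV\<^esub>
    Idl\<^bsub>poly_ring UNIV\<^esub> {row_form A i - cst (\<beta> $ i) | i. True}"

definition fake_exponent ::
    "int ^ 'n ^ 'd \<Rightarrow> complex ^ 'd \<Rightarrow> real ^ 'n \<Rightarrow> complex ^ 'n::finite \<Rightarrow> bool"
  where "fake_exponent A \<beta> w v \<longleftrightarrow> (\<forall>f\<in>fake_indicial_ideal A \<beta> w. peval v f = 0)"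

definition nsupp :: "complex ^ 'n::finite \<Rightarrow> 'n set"
  where "nsupp z = {j. \<exists>m::int. m < 0 \<and> z $ j = of_int m}"


subsection \<open>Standard pairs and the link\<close>

definition standard_pairs :: "'n::finite mpol set \<Rightarrow> (('n \<Rightarrow>\<^sub>0 nat) \<times> 'n set) set"
  where "standard_pairs M = {(a, \<sigma>).
    (\<forall>i\<in>\<sigma>. Poly_Mapping.lookup a i = 0) \<and>
    (\<forall>b :: 'n \<Rightarrow> nat. mon a * (\<Prod>j\<in>\<sigma>. var j ^ b j) \<notin> M) \<and>
    (\<forall>l. l \<notin> \<sigma> \<longrightarrow> (\<exists>b :: 'n \<Rightarrow> nat. mon a * (\<Prod>j\<in>\<sigma> \<union> {l}. var j ^ b j) \<in> M))}"

definition standard_pairs_at ::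
    "int ^ 'n ^ 'd \<Rightarrow> real ^ 'n \<Rightarrow> complex ^ 'n::finite \<Rightarrow> (('n \<Rightarrow>\<^sub>0 nat) \<times> 'n set) set"
  where "standard_pairs_at A w v =
    {(a, \<sigma>) \<in> standard_pairs (initial_ideal w (toric_ideal A)).
       \<forall>j. j \<notin> \<sigma> \<longrightarrow> v $ j = of_nat (Poly_Mapping.lookup a j)}"

definition fake_complex :: "int ^ 'n ^ 'd \<Rightarrow> real ^ 'n \<Rightarrow> complex ^ 'n::finite \<Rightarrow> 'n set set"
  where "fake_complex A w v = {\<tau>. \<exists>(a, \<sigma>)\<in>standard_pairs_at A w v. \<tau> \<subseteq> \<sigma>}"

definition fake_link :: "int ^ 'n ^ 'd \<Rightarrow> real ^ 'n \<Rightarrow> complex ^ 'n::finite \<Rightarrow> 'n set set"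
  where "fake_link A w v =
    {\<tau> \<in> fake_complex A w v. \<tau> \<inter> nsupp v = {} \<and> \<tau> \<union> nsupp v \<in> fake_complex A w v}"


subsection \<open>Stanley-Reisner rings\<close>

definition sr_ideal :: "'n set \<Rightarrow> 'n set set \<Rightarrow> 'n mpol set"
  where "sr_ideal V \<Delta> = Idl\<^bsub>poly_ring V\<^esub> {\<Prod>i\<in>\<tau>. var i | \<tau>. \<tau> \<subseteq> V \<and> \<tau> \<notin> \<Delta>}"

definition sr_ring :: "'n set \<Rightarrow> 'n set set \<Rightarrow> 'n mpol set ring"
  where "sr_ring V \<Delta> = poly_ring V Quot sr_ideal V \<Delta>"

definition sr_class :: "'n set \<Rightarrow> 'n set set \<Rightarrow> 'n mpol \<Rightarrow> 'n mpol set"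
  where "sr_class V \<Delta> p = sr_ideal V \<Delta> +>\<^bsub>poly_ring V\<^esub> p"

definition linear_form_in :: "'n set \<Rightarrow> 'n mpol \<Rightarrow> bool"
  where "linear_form_in V p \<longleftrightarrow> (\<exists>c. p = (\<Sum>j\<in>V. cst (c j) * var j))"

text \<open>
  The vector space structure of a quotient of $\mathbb{C}[\Delta]$ by an ideal \<open>J\<close> is given by
  multiplication with the classes of the constants.
\<close>

definition sr_quotient_finite_dim :: "'n set \<Rightarrow> 'n set set \<Rightarrow> 'n mpol set set \<Rightarrow> bool"
  where "sr_quotient_finite_dim V \<Delta> J \<longleftrightarrow>
    ring.finite_dimension (sr_ring V \<Delta> Quot J)
      (range (\<lambda>c. J +>\<^bsub>sr_ring V \<Delta>\<^esub> sr_class V \<Delta> (cst c)))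
      (carrier (sr_ring V \<Delta> Quot J))"

end

theory Submission
  imports Defs
begin

text \<open>
  If \<open>(a, \<sigma>)\<close> is a standard pair of the initial ideal, the columns of \<open>A\<close> indexed by \<open>\<sigma>\<close> are linearly
  independent: an integer relation among them gives a binomial of the toric ideal supported on \<open>\<sigma>\<close>,
  one of whose monomials lies in the initial ideal.  Hence for \<open>j \<in> \<sigma>\<close> some combination of the row
  forms is \<open>x\<^sub>j\<close> plus a linear form in the variables outside \<open>\<sigma>\<close>.  If \<open>\<tau>\<close> is a face of the link
  containing \<open>j\<close> and \<open>\<tau> \<union> I\<^sub>0 \<subseteq> \<sigma>\<close>, this form does not involve \<open>I\<^sub>0\<close>, so it lies in the ideal of the
  \<open>\<ll>\<^sub>q\<close> and rewrites \<open>x\<^sub>j\<close> through variables outside \<open>\<tau>\<close>.  Applied to a repeated variable of a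
  monomial with support \<open>\<tau>\<close>, it strictly enlarges the support; the process stops at nonfaces, which
  vanish, and at squarefree monomials.  So finitely many squarefree monomials span the quotient.
\<close>

section \<open>Polynomials\<close>

lemma vars_zero [simp]: "vars 0 = {}"
  by (simp add: vars_def)

lemma vars_cst [simp]: "vars (cst c) = {}"
  by (simp add: vars_def cst_def)

lemma vars_one [simp]: "vars 1 = {}"
  by (simp add: vars_def)

lemma vars_mon [simp]: "vars (mon u) = Poly_Mapping.keys u"
  by (simp add: vars_def mon_def)

lemma vars_var [simp]: "vars (var j) = {j}"
  by (simp add: var_def)

lemma vars_uminus [simp]: "vars (- p) = vars p"
  by (simp add: vars_def in_keys_iff)

lemma vars_add: "vars p \<subseteq> V \<Longrightarrow> vars q \<subseteq> V \<Longrightarrow> vars (p + q) \<subseteq> V"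
  unfolding vars_def using keys_add[of p q] by blast

lemma vars_mult: "vars p \<subseteq> V \<Longrightarrow> vars q \<subseteq> V \<Longrightarrow> vars (p * q) \<subseteq> V"
proof
  fix i assume V: "vars p \<subseteq> V" "vars q \<subseteq> V" and "i \<in> vars (p * q)"
  then obtain a b where "a \<in> Poly_Mapping.keys p" "b \<in> Poly_Mapping.keys q"
    "i \<in> Poly_Mapping.keys (a + b)"
    unfolding vars_def using keys_mult[of p q] by blast
  then show "i \<in> V"
    using keys_add[of a b] V unfolding vars_def by blast
qed

lemma vars_sum: "(\<And>i. i \<in> S \<Longrightarrow> vars (f i) \<subseteq> V) \<Longrightarrow> vars (\<Sum>i\<in>S. f i) \<subseteq> V"
  by (induction S rule: infinite_finite_induct) (simp_all add: vars_add)

lemma vars_prod: "(\<And>i. i \<in> S \<Longrightarrow> vars (f i) \<subseteq> V) \<Longrightarrow> vars (\<Prod>i\<in>S. f i) \<subseteq> V"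
  by (induction S rule: infinite_finite_induct) (simp_all add: vars_mult)

lemma vars_prod_var: "T \<subseteq> V \<Longrightarrow> vars (\<Prod>i\<in>T. var i) \<subseteq> V"
  by (intro vars_prod) auto

lemma vars_power: "vars p \<subseteq> V \<Longrightarrow> vars (p ^ m) \<subseteq> V"
  by (induction m) (simp_all add: vars_mult)

section \<open>Constants, monomials and the expansion of a polynomial into monomials\<close>

lemma cst_0 [simp]: "cst 0 = 0"
  and cst_1 [simp]: "cst 1 = 1"
  by (simp_all add: cst_def)

lemma cst_add: "cst (a + b) = cst a + cst b"
  by (simp add: cst_def single_add)

lemma cst_minus: "cst (- a) = - cst a"
  by (simp add: cst_def single_uminus)

lemma cst_mult: "cst (a * b) = cst a * cst b"
  by (simp add: cst_def mult_single)

lemma cst_sum: "cst (\<Sum>i\<in>S. f i) = (\<Sum>i\<in>S. cst (f i))"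
  by (induction S rule: infinite_finite_induct) (simp_all add: cst_add)

lemma mon_0 [simp]: "mon 0 = 1"
  by (simp add: mon_def)

lemma mon_add: "mon (u + t) = mon u * mon t"
  by (simp add: mon_def mult_single)

lemma cst_mult_mon: "cst c * mon u = Poly_Mapping.single u c"
  by (simp add: cst_def mon_def mult_single)

lemma var_power: "var j ^ m = mon (Poly_Mapping.single j m)"
  by (induction m) (simp_all add: var_def mon_add[symmetric] single_add[symmetric])

lemma prod_mon: "(\<Prod>i\<in>S. mon (f i)) = mon (\<Sum>i\<in>S. f i)"
  by (induction S rule: infinite_finite_induct) (simp_all add: mon_add)

lemma mon_eq_prod_var:
  fixes u :: "'n::finite \<Rightarrow>\<^sub>0 nat"
  assumes "Poly_Mapping.keys u \<subseteq> S"
  shows "mon u = (\<Prod>j\<in>S. var j ^ Poly_Mapping.lookup u j)"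
proof -
  have "u = (\<Sum>j\<in>S. Poly_Mapping.single j (Poly_Mapping.lookup u j))"
    using assms by (intro poly_mapping_eqI)
      (auto simp: lookup_sum lookup_single when_def in_keys_iff)
  then show ?thesis
    by (metis (no_types, lifting) prod_mon prod.cong var_power)
qed

lemma mpol_expansion:
  "p = (\<Sum>u\<in>Poly_Mapping.keys p. cst (Poly_Mapping.lookup p u) * mon u)"
  by (intro poly_mapping_eqI)
    (auto simp: cst_mult_mon lookup_sum lookup_single when_def in_keys_iff)

lemma mpol_induct [case_names zero add monomial]:
  assumes "P 0" "\<And>p q. P p \<Longrightarrow> P q \<Longrightarrow> P (p + q)"
    and "\<And>c u. P (cst c * mon u)"
  shows "P p"
proof -
  have "P (\<Sum>u\<in>S. cst (Poly_Mapping.lookup p u) * mon u)" for S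
    by (induction S rule: infinite_finite_induct) (simp_all add: assms)
  then show ?thesis
    by (metis mpol_expansion)
qed


subsection \<open>Substitution\<close>

text \<open>The value on a monomial of the algebra endomorphism sending \<open>var j\<close> to
  \<open>S j\<close>; \<open>psubst\<close> extends it linearly. It serves to eliminate the
  variables in the negative support.\<close>

definition mon_subst :: "('n::finite \<Rightarrow> 'n mpol) \<Rightarrow> ('n \<Rightarrow>\<^sub>0 nat) \<Rightarrow> 'n mpol"
  where "mon_subst S u = (\<Prod>j\<in>UNIV. S j ^ Poly_Mapping.lookup u j)"

definition psubst :: "('n::finite \<Rightarrow> 'n mpol) \<Rightarrow> 'n mpol \<Rightarrow> 'n mpol"
  where "psubst S p =
    (\<Sum>u\<in>Poly_Mapping.keys p. cst (Poly_Mapping.lookup p u) * mon_subst S u)"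

lemma mon_subst_add: "mon_subst S (u + t) = mon_subst S u * mon_subst S t"
  by (simp add: mon_subst_def lookup_add power_add prod.distrib)

text \<open>Terms of \<open>p\<close> and \<open>q\<close> may cancel in \<open>p + q\<close>, so
  additivity is proved by summing over one common index set; the extra terms have coefficient
  0.\<close>

lemma psubst_superset:
  assumes "finite U" "Poly_Mapping.keys p \<subseteq> U"
  shows "psubst S p = (\<Sum>u\<in>U. cst (Poly_Mapping.lookup p u) * mon_subst S u)"
  unfolding psubst_def using assms
  by (intro sum.mono_neutral_left) (auto simp: in_keys_iff)

lemma psubst_0 [simp]: "psubst S 0 = 0"
  by (simp add: psubst_def)

lemma psubst_add: "psubst S (p + q) = psubst S p + psubst S q"
proof -
  let ?U = "Poly_Mapping.keys p \<union> Poly_Mapping.keys q"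
  have "psubst S r = (\<Sum>u\<in>?U. cst (Poly_Mapping.lookup r u) * mon_subst S u)"
    if "r \<in> {p, q, p + q}" for r
    using that keys_add[of p q] by (intro psubst_superset) auto
  then show ?thesis
    by (simp add: lookup_add cst_add distrib_right sum.distrib)
qed

lemma psubst_uminus: "psubst S (- p) = - psubst S p"
  using psubst_add[of S p "- p"] by (simp add: eq_neg_iff_add_eq_0 add.commute)

lemma psubst_diff: "psubst S (p - q) = psubst S p - psubst S q"
  using psubst_add[of S p "- q"] by (simp add: psubst_uminus)

lemma psubst_sum: "psubst S (\<Sum>i\<in>T. f i) = (\<Sum>i\<in>T. psubst S (f i))"
  by (induction T rule: infinite_finite_induct) (simp_all add: psubst_add)

lemma psubst_cst_mon: "psubst S (cst c * mon u) = cst c * mon_subst S u"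
  by (simp add: cst_mult_mon psubst_def)

lemma psubst_mult: "psubst S (p * q) = psubst S p * psubst S q"
proof (induction p rule: mpol_induct)
  case (monomial c u)
  show ?case
  proof (induction q rule: mpol_induct)
    case (monomial d t)
    have "cst c * mon u * (cst d * mon t) = cst (c * d) * mon (u + t)"
      by (simp add: cst_mult mon_add mult_ac)
    then show ?case
      by (simp only: psubst_cst_mon) (simp add: mon_subst_add cst_mult mult_ac)
  qed (simp_all add: psubst_add distrib_left)
qed (simp_all add: psubst_add distrib_right)

lemma psubst_cst: "psubst S (cst c) = cst c"
  using psubst_cst_mon[of S c 0] by (simp add: mon_subst_def)

lemma psubst_var: "psubst S (var j) = S j"
proof -
  have "psubst S (var j) = mon_subst S (Poly_Mapping.single j 1)"
    using psubst_cst_mon[of S 1 "Poly_Mapping.single j 1"] by (simp add: var_def)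
  also have "\<dots> = (\<Prod>i\<in>UNIV. if i = j then S j else 1)"
    unfolding mon_subst_def by (intro prod.cong) (auto simp: lookup_single)
  finally show ?thesis by simp
qed

lemma vars_psubst: "(\<And>j. vars (S j) \<subseteq> V) \<Longrightarrow> vars (psubst S p) \<subseteq> V"
  unfolding psubst_def mon_subst_def
  by (intro vars_sum vars_mult vars_prod vars_power) simp_all

lemma psubst_linear_form:
  "psubst S (\<Sum>j\<in>T. cst (c j) * var j) = (\<Sum>j\<in>T. cst (c j) * S j)"
  by (simp add: psubst_sum psubst_mult psubst_cst psubst_var)


subsection \<open>The rings \<open>poly_ring V\<close>\<close>

lemma poly_ring_simps [simp]:
  "carrier (poly_ring V) = {p. vars p \<subseteq> V}"
  "p \<otimes>\<^bsub>poly_ring V\<^esub> q = p * q"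
  "p \<oplus>\<^bsub>poly_ring V\<^esub> q = p + q"
  "\<one>\<^bsub>poly_ring V\<^esub> = 1"
  "\<zero>\<^bsub>poly_ring V\<^esub> = 0"
  by (simp_all add: poly_ring_def)

lemma cring_poly_ring: "cring (poly_ring V)"
proof (rule cringI)
  show "abelian_group (poly_ring V)"
  proof (rule abelian_groupI)
    fix p assume "p \<in> carrier (poly_ring V)"
    then show "\<exists>q\<in>carrier (poly_ring V). q \<oplus>\<^bsub>poly_ring V\<^esub> p = \<zero>\<^bsub>poly_ring V\<^esub>"
      by (intro bexI[of _ "- p"]) simp_all
  qed (simp_all add: vars_add add_ac)
  show "comm_monoid (poly_ring V)"
    by (rule comm_monoidI) (simp_all add: vars_mult mult_ac)
qed (simp add: distrib_right)

lemma ring_poly_ring: "ring (poly_ring V)"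
  using cring_poly_ring by (rule cring.axioms)

lemma poly_ring_a_inv:
  assumes "vars p \<subseteq> V" shows "\<ominus>\<^bsub>poly_ring V\<^esub> p = - p"
proof -
  interpret ring "poly_ring V" by (rule ring_poly_ring)
  show ?thesis
    using assms minus_equality[of "- p" p] by simp
qed

section \<open>Ideals and scalars of the polynomial rings\<close>

text \<open>Closure under negation is absorption of the factor \<open>- 1\<close>, and commutativity
  makes one-sided absorption two-sided.\<close>

lemma ideal_poly_ringI:
  assumes "I \<subseteq> {p. vars p \<subseteq> V}" "0 \<in> I" "\<And>p q. p \<in> I \<Longrightarrow> q \<in> I \<Longrightarrow> p + q \<in> I"
    and mult: "\<And>p q. p \<in> I \<Longrightarrow> vars q \<subseteq> V \<Longrightarrow> q * p \<in> I"
  shows "ideal I (poly_ring V)"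
proof (rule idealI[OF ring_poly_ring])
  have "\<ominus>\<^bsub>poly_ring V\<^esub> p \<in> I" if "p \<in> I" for p
    using mult[OF that, of "- 1"] that assms(1) by (auto simp: poly_ring_a_inv)
  then show "subgroup I (add_monoid (poly_ring V))"
    using assms(1-3) abelian_group.a_group[OF ring.is_abelian_group[OF ring_poly_ring]]
    by (intro group.subgroupI) (auto simp: a_inv_def)
qed (use mult in \<open>auto simp: mult.commute\<close>)

lemma
  assumes "ideal I (poly_ring V)"
  shows poly_ideal_add: "p \<in> I \<Longrightarrow> q \<in> I \<Longrightarrow> p + q \<in> I"
    and poly_ideal_mult: "p \<in> I \<Longrightarrow> vars q \<subseteq> V \<Longrightarrow> q * p \<in> I"
    and poly_ideal_0: "0 \<in> I"
proof -
  interpret ideal I "poly_ring V" by fact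
  show "p \<in> I \<Longrightarrow> q \<in> I \<Longrightarrow> p + q \<in> I" "p \<in> I \<Longrightarrow> vars q \<subseteq> V \<Longrightarrow> q * p \<in> I"
    "0 \<in> I"
    using additive_subgroup.a_closed[OF is_additive_subgroup, of p q] I_l_closed[of p q]
      additive_subgroup.zero_closed[OF is_additive_subgroup]
    by simp_all
qed

lemma poly_ideal_sum:
  assumes "ideal I (poly_ring V)" "\<And>i. i \<in> S \<Longrightarrow> f i \<in> I"
  shows "(\<Sum>i\<in>S. f i) \<in> I"
  using assms(2)
  by (induction S rule: infinite_finite_induct)
    (simp_all add: poly_ideal_0[OF assms(1)] poly_ideal_add[OF assms(1)])

text \<open>Dimension is measured over a subfield of the ring. The constants form one, and their
  image in the final quotient is the field of scalars there.\<close>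

lemma subfield_cst: "subfield (range cst) (poly_ring V)"
proof -
  interpret cring "poly_ring V" by (rule cring_poly_ring)
  have "subcring (range cst) (poly_ring V)"
  proof (rule subcringI')
    show "subring (range cst) (poly_ring V)"
    proof (rule subringI)
      show "\<one>\<^bsub>poly_ring V\<^esub> \<in> range cst"
        by (metis cst_1 poly_ring_simps(4) rangeI)
      fix p q :: "'a mpol" assume "p \<in> range cst" "q \<in> range cst"
      then show "p \<otimes>\<^bsub>poly_ring V\<^esub> q \<in> range cst" "p \<oplus>\<^bsub>poly_ring V\<^esub> q \<in> range cst"
          "\<ominus>\<^bsub>poly_ring V\<^esub> p \<in> range cst"
        by (auto simp: poly_ring_a_inv simp flip: cst_mult cst_add cst_minus)
    qed auto
  qed
  moreover have "Units (poly_ring V\<lparr>carrier := range cst\<rparr>) = range cst - {0}"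
  proof
    show "range cst - {0} \<subseteq> Units (poly_ring V\<lparr>carrier := range cst\<rparr>)"
    proof
      fix p :: "'a mpol" assume "p \<in> range cst - {0}"
      then obtain c where "p = cst c" "c \<noteq> 0" by (metis DiffE cst_0 imageE singletonI)
      then have "p * cst (inverse c) = 1" "cst (inverse c) * p = 1"
        by (simp_all flip: cst_mult)
      then show "p \<in> Units (poly_ring V\<lparr>carrier := range cst\<rparr>)"
        using \<open>p = cst c\<close> by (auto simp: Units_def)
    qed
  qed (auto simp: Units_def)
  ultimately show ?thesis
    by (intro subfieldI) simp_all
qed


section \<open>Quotients of Stanley-Reisner rings\<close>

text \<open>The rewriting argument, free of quotient rings: \<open>H\<close> is any complex subspace
  containing \<open>I\<close> and the squarefree monomials. The induction is on the number of
  variables of \<open>V\<close> missing from the support of a monomial. Later \<open>I\<close> is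
  the kernel of the map to the quotient and \<open>H\<close> the preimage of a span.\<close>

lemma squarefree_monomials_generate:
  fixes V :: "'n::finite set"
  assumes I: "ideal I (poly_ring V)" "I \<subseteq> H"
    and H: "0 \<in> H" "\<And>p q. p \<in> H \<Longrightarrow> q \<in> H \<Longrightarrow> p + q \<in> H" "\<And>c p. p \<in> H \<Longrightarrow> cst c * p \<in> H"
    and squarefree: "\<And>T. T \<subseteq> V \<Longrightarrow> (\<Prod>i\<in>T. var i) \<in> H"
    and nonface: "\<And>T. T \<subseteq> V \<Longrightarrow> T \<notin> \<Delta> \<Longrightarrow> (\<Prod>i\<in>T. var i) \<in> I"
    and face: "\<And>T j. T \<subseteq> V \<Longrightarrow> T \<in> \<Delta> \<Longrightarrow> j \<in> T \<Longrightarrow>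
      \<exists>c. var j + (\<Sum>i\<in>V - T. cst (c i) * var i) \<in> I"
    and p: "vars p \<subseteq> V"
  shows "p \<in> H"
proof -
  have H_sum: "(\<Sum>i\<in>S. f i) \<in> H" if "\<And>i. i \<in> S \<Longrightarrow> f i \<in> H" for S :: "'b set" and f
    using that by (induction S rule: infinite_finite_induct) (simp_all add: H)
  have mon_H: "mon u \<in> H" if "Poly_Mapping.keys u \<subseteq> V" for u
    using that
  proof (induction "card (V - Poly_Mapping.keys u)" arbitrary: u rule: less_induct)
    case less
    define T where "T = Poly_Mapping.keys u"
    have T: "T \<subseteq> V" and mon_u: "mon u = (\<Prod>j\<in>T. var j ^ Poly_Mapping.lookup u j)"
      using less.prems mon_eq_prod_var[of u "Poly_Mapping.keys u"] by (simp_all add: T_def)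
    consider "T \<notin> \<Delta>" | "T \<in> \<Delta>" "\<forall>j\<in>T. Poly_Mapping.lookup u j \<le> 1"
      | j where "T \<in> \<Delta>" "j \<in> T" "Poly_Mapping.lookup u j \<ge> 2"
      by fastforce
    then show ?case
    proof cases
      case 1
      \<comment> \<open>The support is a nonface: its squarefree monomial lies in \<open>I\<close>
        and divides \<open>mon u\<close>.\<close>
      have "var j ^ Poly_Mapping.lookup u j = var j ^ (Poly_Mapping.lookup u j - 1) * var j"
        if "j \<in> T" for j
        using that power_minus_mult[of "Poly_Mapping.lookup u j" "var j"]
        by (simp add: T_def in_keys_iff)
      then have "mon u = (\<Prod>j\<in>T. var j ^ (Poly_Mapping.lookup u j - 1)) * (\<Prod>j\<in>T. var j)"
        by (simp add: mon_u prod.distrib[symmetric])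
      moreover have "vars (\<Prod>j\<in>T. var j ^ (Poly_Mapping.lookup u j - 1)) \<subseteq> V"
        using T by (intro vars_prod vars_power) auto
      ultimately show ?thesis
        using poly_ideal_mult[OF I(1) nonface[OF T 1]] I(2) by auto
    next
      case 2
      have "Poly_Mapping.lookup u j = 1" if "j \<in> T" for j
      proof -
        have "Poly_Mapping.lookup u j \<noteq> 0"
          using that by (simp add: T_def in_keys_iff)
        then show ?thesis
          using 2(2) that by (meson le_antisym less_one not_less)
      qed
      then have "mon u = (\<Prod>j\<in>T. var j)"
        by (simp add: mon_u)
      then show ?thesis
        using squarefree[OF T] by simp
    next
      case 3
      obtain c where c: "var j + (\<Sum>i\<in>V - T. cst (c i) * var i) \<in> I"
        using face[OF T 3(1,2)] by blast
      define t where "t = u - Poly_Mapping.single j 1"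
      have u: "u = t + Poly_Mapping.single j 1"
        using 3(3) unfolding t_def
        by (intro poly_mapping_eqI) (auto simp: lookup_add lookup_minus lookup_single when_def)
      \<comment> \<open>The exponent of \<open>j\<close> is at least 2, so one factor
        \<open>var j\<close> can be removed without shrinking the support. Multiplying by a variable
        outside \<open>T\<close> then enlarges it.\<close>
      have keys_t: "Poly_Mapping.keys t = T"
        using 3(3) unfolding T_def t_def
        by (auto simp: in_keys_iff lookup_minus lookup_single when_def split: if_splits)
      have "mon (t + Poly_Mapping.single i 1) \<in> H" if i: "i \<in> V - T" for i
      proof (rule less.hyps)
        have *: "Poly_Mapping.keys (t + Poly_Mapping.single i 1) = insert i T"
          using keys_t by (auto simp: in_keys_iff lookup_add lookup_single when_def split: if_splits)
        show "Poly_Mapping.keys (t + Poly_Mapping.single i 1) \<subseteq> V"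
          using * i T by simp
        show "card (V - Poly_Mapping.keys (t + Poly_Mapping.single i 1))
            < card (V - Poly_Mapping.keys u)"
          unfolding * T_def[symmetric] using i by (intro psubset_card_mono) auto
      qed
      then have "(\<Sum>i\<in>V - T. cst (- c i) * mon (t + Poly_Mapping.single i 1)) \<in> H"
        by (intro H_sum H)
      moreover have "mon t * (var j + (\<Sum>i\<in>V - T. cst (c i) * var i)) \<in> H"
        using poly_ideal_mult[OF I(1) c, of "mon t"] I(2) keys_t T by auto
      \<comment> \<open>Replace one factor \<open>var j\<close> by the given form minus its tail:
        the form contributes an element of \<open>I\<close>, the tail only monomials with larger
        support.\<close>
      moreover have "mon u = mon t * (var j + (\<Sum>i\<in>V - T. cst (c i) * var i))
          + (\<Sum>i\<in>V - T. cst (- c i) * mon (t + Poly_Mapping.single i 1))"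
        by (simp add: u var_def mon_add cst_minus distrib_left sum_distrib_left sum_negf mult_ac)
      ultimately show ?thesis
        by (simp only: H(2))
    qed
  qed
  have "cst (Poly_Mapping.lookup p u) * mon u \<in> H" if "u \<in> Poly_Mapping.keys p" for u
    using that p by (intro H(3) mon_H) (auto simp: vars_def)
  then show ?thesis
    by (subst mpol_expansion[of p]) (rule H_sum)
qed

text \<open>The two successive quotients are combined into one surjection \<open>\<pi>\<close> from
  the polynomial ring. Its kernel contains the nonface monomials and \<open>G\<close>, so the images
  of the finitely many squarefree monomials span the target.\<close>

lemma sr_quotient_finite_dimI:
  fixes V :: "'n::finite set"
  assumes G: "\<And>g. g \<in> G \<Longrightarrow> vars g \<subseteq> V"
    and face: "\<And>T j. T \<subseteq> V \<Longrightarrow> T \<in> \<Delta> \<Longrightarrow> j \<in> T \<Longrightarrow>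
      \<exists>c. var j + (\<Sum>i\<in>V - T. cst (c i) * var i) \<in> Idl\<^bsub>poly_ring V\<^esub> G"
  shows "sr_quotient_finite_dim V \<Delta> (Idl\<^bsub>sr_ring V \<Delta>\<^esub> (sr_class V \<Delta> ` G))"
proof -
  define P where "P = poly_ring V"
  define R where "R = sr_ring V \<Delta>"
  define J where "J = Idl\<^bsub>R\<^esub> (sr_class V \<Delta> ` G)"
  define Q where "Q = R Quot J"
  define \<pi> where "\<pi> = (\<lambda>p. J +>\<^bsub>R\<^esub> sr_class V \<Delta> p)"
  let ?N = "{\<Prod>i\<in>\<tau>. var i | \<tau>. \<tau> \<subseteq> V \<and> \<tau> \<notin> \<Delta>}"
  interpret P: cring P unfolding P_def by (rule cring_poly_ring)
  have prod_carrier: "(\<Prod>i\<in>T. var i) \<in> carrier P" if "T \<subseteq> V" for T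
    using vars_prod_var[OF that] by (simp add: P_def)
  then have N: "?N \<subseteq> carrier P"
    by blast
  interpret S: ideal "sr_ideal V \<Delta>" P
    unfolding sr_ideal_def P_def[symmetric] by (rule P.genideal_ideal[OF N])
  have R_eq: "R = P Quot sr_ideal V \<Delta>"
    by (simp add: R_def P_def sr_ring_def)
  have class_eq: "sr_class V \<Delta> = (+>\<^bsub>P\<^esub>) (sr_ideal V \<Delta>)"
    by (simp add: fun_eq_iff P_def sr_class_def)
  interpret h1: ring_hom_ring P R "sr_class V \<Delta>"
    unfolding R_eq class_eq by (rule S.rcos_ring_hom_ring)
  have "sr_class V \<Delta> ` G \<subseteq> carrier R"
    using G by (auto simp: P_def intro!: h1.hom_closed)
  then interpret J: ideal J R
    unfolding J_def by (rule h1.S.genideal_ideal)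
  interpret h2: ring_hom_ring R Q "(+>\<^bsub>R\<^esub>) J"
    unfolding Q_def by (rule J.rcos_ring_hom_ring)
  have \<pi>_eq: "\<pi> = (+>\<^bsub>R\<^esub>) J \<circ> sr_class V \<Delta>"
    by (simp add: \<pi>_def fun_eq_iff)
  interpret \<pi>: ring_hom_ring P Q \<pi>
    using ring_hom_trans[OF h1.homh h2.homh] unfolding \<pi>_eq
    by (intro ring_hom_ringI2) (simp_all add: h2.S.ring_axioms P.ring_axioms)
  have zero_R: "\<zero>\<^bsub>R\<^esub> = sr_ideal V \<Delta>" and zero_Q: "\<zero>\<^bsub>Q\<^esub> = J"
    by (simp_all add: R_eq Q_def FactRing_def)
  define I where "I = a_kernel P Q \<pi>"
  have ideal_I: "ideal I P"
    unfolding I_def by (rule \<pi>.kernel_is_ideal)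
  have I_iff: "p \<in> I \<longleftrightarrow> vars p \<subseteq> V \<and> \<pi> p = \<zero>\<^bsub>Q\<^esub>" for p
    unfolding I_def a_kernel_def' by (auto simp: P_def)
  have nonface: "(\<Prod>i\<in>T. var i) \<in> I" if "T \<subseteq> V" "T \<notin> \<Delta>" for T
  proof -
    have "(\<Prod>i\<in>T. var i) \<in> sr_ideal V \<Delta>"
      using P.genideal_self[OF N] that unfolding sr_ideal_def P_def by blast
    then have "sr_class V \<Delta> (\<Prod>i\<in>T. var i) = \<zero>\<^bsub>R\<^esub>"
      unfolding class_eq zero_R by (rule S.a_rcos_const)
    then show ?thesis
      using vars_prod_var[OF that(1)] by (simp add: I_iff \<pi>_eq)
  qed
  have "g \<in> I" if "g \<in> G" for g
  proof -
    have "sr_class V \<Delta> g \<in> J"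
      using h1.S.genideal_self[OF \<open>sr_class V \<Delta> ` G \<subseteq> carrier R\<close>] that unfolding J_def by blast
    then show ?thesis
      using G[OF that] J.a_rcos_const by (simp add: I_iff \<pi>_eq zero_Q)
  qed
  then have Idl_I: "Idl\<^bsub>P\<^esub> G \<subseteq> I"
    by (intro P.genideal_minimal[OF ideal_I]) auto
  have surj: "\<pi> ` carrier P = carrier Q"
    unfolding \<pi>_eq Q_def R_eq class_eq
    by (auto simp: FactRing_def A_RCOSETS_def' image_iff)
  define K where "K = range (\<lambda>c. \<pi> (cst c))"
  have K_eq: "K = \<pi> ` range cst"
    by (auto simp: K_def)
  have "h2.S.finite_dimension K (carrier Q)"
  proof (cases "\<one>\<^bsub>Q\<^esub> = \<zero>\<^bsub>Q\<^esub>")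
    \<comment> \<open>A subfield needs distinct 0 and 1, so the zero ring is treated separately; it
      occurs, for instance, when the empty set is a nonface.\<close>
    case True
    then have "carrier Q = {\<zero>\<^bsub>Q\<^esub>}"
      by (rule h2.S.one_zeroD)
    then show ?thesis
      using h2.S.finite_dimensionI[OF h2.S.dimension.zero_dim] by simp
  next
    case False
    have K: "subfield K Q"
      unfolding K_eq using False
      by (intro \<pi>.img_is_subfield(2)) (simp_all add: P_def subfield_cst)
    obtain Us where Us: "set Us = (\<lambda>T. \<pi> (\<Prod>i\<in>T. var i)) ` Pow V"
      using finite_list[of "(\<lambda>T. \<pi> (\<Prod>i\<in>T. var i)) ` Pow V"] by auto
    have Us_carrier: "set Us \<subseteq> carrier Q"
      unfolding Us using prod_carrier by (auto intro!: \<pi>.hom_closed)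
    define E where "E = h2.S.Span K Us"
    note E_sub = h2.S.Span_subgroup_props[OF K Us_carrier, folded E_def]
    \<comment> \<open>The preimage under \<open>\<pi>\<close> of the span; showing that it is the
      whole polynomial ring suffices because \<open>\<pi>\<close> is surjective.\<close>
    define H where "H = {p. vars p \<subseteq> V \<and> \<pi> p \<in> E}"
    have "p \<in> H" if "vars p \<subseteq> V" for p
    proof (rule squarefree_monomials_generate[where I = I and V = V and \<Delta> = \<Delta>])
      show "I \<subseteq> H"
        using E_sub by (auto simp: I_iff H_def)
      show "0 \<in> H"
        using E_sub \<pi>.hom_zero by (simp add: H_def P_def)
      show "p + q \<in> H" if "p \<in> H" "q \<in> H" for p q
        using that E_sub \<pi>.hom_add[of p q] by (auto simp: H_def P_def vars_add)
      show "cst c * p \<in> H" if "p \<in> H" for c p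
        using that h2.S.Span_smult_closed[OF K Us_carrier, of "\<pi> (cst c)" "\<pi> p", folded E_def]
          \<pi>.hom_mult[of "cst c" p] by (auto simp: H_def P_def K_def vars_mult)
      show "(\<Prod>i\<in>T. var i) \<in> H" if "T \<subseteq> V" for T
        using that h2.S.Span_base_incl[OF K Us_carrier, folded E_def] Us vars_prod_var[OF that]
        by (auto simp: H_def)
      show "\<exists>c. var j + (\<Sum>i\<in>V - T. cst (c i) * var i) \<in> I"
        if "T \<subseteq> V" "T \<in> \<Delta>" "j \<in> T" for T j
        using face[OF that] Idl_I unfolding P_def by blast
    qed (use ideal_I nonface that in \<open>simp_all add: P_def\<close>)
    then have "carrier Q \<subseteq> E"
      unfolding surj[symmetric] by (auto simp: H_def P_def)
    then have "carrier Q = E"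
      using E_sub(1) by blast
    then show ?thesis
      using h2.S.Span_finite_dimension[OF K Us_carrier] by (simp add: E_def)
  qed
  then show ?thesis
    by (simp add: sr_quotient_finite_dim_def K_def Q_def \<pi>_def J_def R_def)
qed


section \<open>Standard pairs of toric initial ideals\<close>

lemma ideal_genideal_UNIV: "ideal (Idl\<^bsub>poly_ring UNIV\<^esub> S) (poly_ring UNIV)"
  by (intro ring.genideal_ideal ring_poly_ring) simp

lemma in_genideal_UNIV: "p \<in> S \<Longrightarrow> p \<in> Idl\<^bsub>poly_ring UNIV\<^esub> S"
  using ring.genideal_self[OF ring_poly_ring, of S UNIV] by auto

text \<open>The polynomials all of whose monomials lie in \<open>M\<close> form an ideal. It
  contains the monomial generators of \<open>M\<close>, hence all of \<open>M\<close>.\<close>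

lemma monomial_ideal_keys:
  assumes M: "monomial_ideal M" and p: "p \<in> M" and u: "u \<in> Poly_Mapping.keys p"
  shows "mon u \<in> M"
proof -
  obtain U where U: "M = Idl\<^bsub>poly_ring UNIV\<^esub> (mon ` U)"
    using M by (auto simp: monomial_ideal_def)
  have ideal_M: "ideal M (poly_ring UNIV)"
    unfolding U by (rule ideal_genideal_UNIV)
  let ?J = "{q. \<forall>t\<in>Poly_Mapping.keys q. mon t \<in> M}"
  have "ideal ?J (poly_ring UNIV)"
  proof (rule ideal_poly_ringI)
    show "q + r \<in> ?J" if "q \<in> ?J" "r \<in> ?J" for q r
      using that keys_add[of q r] by blast
    show "r * q \<in> ?J" if "q \<in> ?J" for q r
    proof safe
      fix t assume "t \<in> Poly_Mapping.keys (r * q)"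
      then obtain a b where "t = a + b" "b \<in> Poly_Mapping.keys q"
        using keys_mult[of r q] by blast
      then show "mon t \<in> M"
        using that poly_ideal_mult[OF ideal_M, of "mon b" "mon a"] by (simp add: mon_add)
    qed
  qed auto
  moreover have "mon t \<in> ?J" if "t \<in> U" for t
    using that in_genideal_UNIV[of "mon t" "mon ` U"] by (simp add: U) (simp add: mon_def)
  ultimately have "M \<subseteq> ?J"
    unfolding U by (intro ring.genideal_minimal[OF ring_poly_ring]) (auto simp: U)
  then show ?thesis
    using p u by blast
qed

lemma lookup_initial_form:
  "Poly_Mapping.lookup (initial_form w p) u =
    (if \<forall>t\<in>Poly_Mapping.keys p. weight w t \<le> weight w u then Poly_Mapping.lookup p u else 0)"
  unfolding initial_form_def
  by (auto simp: lookup_sum lookup_single when_def in_keys_iff)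

text \<open>The initial form of the binomial \<open>mon u - mon t\<close> contains \<open>u\<close>
  with coefficient 1, also when the weights agree and this form is the whole binomial. Monomiality
  then isolates \<open>mon u\<close>.\<close>

lemma initial_ideal_contains_leading_monomial:
  assumes M: "monomial_ideal (initial_ideal w (toric_ideal A))"
    and eq: "exponent_image A u = exponent_image A t" and "u \<noteq> t" "weight w t \<le> weight w u"
  shows "mon u \<in> initial_ideal w (toric_ideal A)"
proof (rule monomial_ideal_keys[OF M])
  have "mon u - mon t \<in> toric_ideal A"
    unfolding toric_ideal_def using eq by (intro in_genideal_UNIV) blast
  then show "initial_form w (mon u - mon t) \<in> initial_ideal w (toric_ideal A)"
    unfolding initial_ideal_def by (intro in_genideal_UNIV) blast
  have "Poly_Mapping.lookup (mon u - mon t) u = 1"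
    using \<open>u \<noteq> t\<close> by (simp add: mon_def lookup_minus lookup_single)
  moreover have "Poly_Mapping.keys (mon u - mon t) \<subseteq> {u, t}"
    by (auto simp: mon_def in_keys_iff lookup_minus lookup_single when_def split: if_splits)
  ultimately show "u \<in> Poly_Mapping.keys (initial_form w (mon u - mon t))"
    using \<open>weight w t \<le> weight w u\<close> by (auto simp: in_keys_iff lookup_initial_form)
qed

text \<open>Otherwise its multiple by \<open>mon a\<close> would lie in the ideal too, against
  condition (ii) of a standard pair.\<close>

lemma standard_pair_mon_notin:
  assumes "(a, \<sigma>) \<in> standard_pairs (initial_ideal w I)" "Poly_Mapping.keys u \<subseteq> \<sigma>"
  shows "mon u \<notin> initial_ideal w I"
proof
  assume "mon u \<in> initial_ideal w I"
  then have "mon a * mon u \<in> initial_ideal w I"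
    unfolding initial_ideal_def by (rule poly_ideal_mult[OF ideal_genideal_UNIV]) simp
  then show False
    using assms by (auto simp: standard_pairs_def mon_eq_prod_var)
qed

lemma standard_pair_int_kernel:
  fixes A :: "int ^ 'n::finite ^ 'd::finite" and z :: "int ^ 'n"
  assumes M: "monomial_ideal (initial_ideal w (toric_ideal A))"
    and pair: "(a, \<sigma>) \<in> standard_pairs (initial_ideal w (toric_ideal A))"
    and z: "A *v z = 0" "\<And>j. j \<notin> \<sigma> \<Longrightarrow> z $ j = 0"
  shows "z = 0"
proof (rule ccontr)
  assume "z \<noteq> 0"
  \<comment> \<open>The positive and negative parts of \<open>z\<close>. Both are supported in
    \<open>\<sigma>\<close>, yet the one of larger weight gives a monomial of the initial
    ideal.\<close>
  define u t :: "'n \<Rightarrow>\<^sub>0 nat"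
    where "u = Abs_poly_mapping (\<lambda>j. nat (z $ j))" and "t = Abs_poly_mapping (\<lambda>j. nat (- z $ j))"
  have lookup: "Poly_Mapping.lookup u j = nat (z $ j)" "Poly_Mapping.lookup t j = nat (- z $ j)" for j
    by (simp_all add: u_def t_def)
  have z_eq: "z = (\<chi> j. int (Poly_Mapping.lookup u j)) - (\<chi> j. int (Poly_Mapping.lookup t j))"
    by (simp add: vec_eq_iff lookup)
  have "A *v z = exponent_image A u - exponent_image A t"
    unfolding exponent_image_def by (subst z_eq) (rule matrix_vector_mult_diff_distrib)
  then have eq: "exponent_image A u = exponent_image A t"
    using z(1) by simp
  have "u \<noteq> t"
    using \<open>z \<noteq> 0\<close> z_eq by auto
  have keys: "Poly_Mapping.keys u \<subseteq> \<sigma>" "Poly_Mapping.keys t \<subseteq> \<sigma>"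
    using z(2) by (force simp: in_keys_iff lookup)+
  consider "weight w t \<le> weight w u" | "weight w u \<le> weight w t"
    by linarith
  then show False
  proof cases
    case 1
    then show False
      using initial_ideal_contains_leading_monomial[OF M eq \<open>u \<noteq> t\<close>]
        standard_pair_mon_notin[OF pair keys(1)] by blast
  next
    case 2
    then show False
      using initial_ideal_contains_leading_monomial[OF M eq[symmetric]] \<open>u \<noteq> t\<close>
        standard_pair_mon_notin[OF pair keys(2)] by blast
  qed
qed

section \<open>From integer relations to rational independence and dual rows\<close>

lemma common_denominator:
  fixes x :: "'a \<Rightarrow> rat"
  assumes "finite S"
  shows "\<exists>D>0. \<forall>j\<in>S. \<exists>m. of_int D * x j = of_int m"
  using assms
proof (induction S rule: finite_induct)
  case empty
  show ?case by (intro exI[of _ 1]) simp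
next
  case (insert i S)
  then obtain D where D: "D > 0" "\<forall>j\<in>S. \<exists>m. of_int D * x j = of_int m" by blast
  obtain p q where q: "x i = of_int p / of_int q" "q > 0"
    by (metis quotient_of_denom_pos quotient_of_div surj_pair)
  have "\<exists>m. of_int (D * q) * x j = of_int m" if "j \<in> insert i S" for j
  proof (cases "j = i")
    case True
    then show ?thesis
      using q by (intro exI[of _ "D * p"]) simp
  next
    case False
    then have "j \<in> S"
      using that by simp
    then have "\<exists>m. of_int D * x j = of_int m"
      using D(2) by (rule bspec[rotated])
    then obtain m where "of_int D * x j = of_int m" ..
    then have "of_int (D * q) * x j = of_int (m * q)"
      by (metis mult.assoc mult.commute of_int_mult)
    then show ?thesis ..
  qed
  then show ?case
    using D(1) q(2) by (intro exI[of _ "D * q"]) simp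
qed

text \<open>Binomials encode only integer relations among the columns, so a rational relation is
  first cleared of denominators.\<close>

lemma standard_pair_rat_kernel:
  fixes A :: "int ^ 'n::finite ^ 'd::finite" and x :: "rat ^ 'n"
  assumes M: "monomial_ideal (initial_ideal w (toric_ideal A))"
    and pair: "(a, \<sigma>) \<in> standard_pairs (initial_ideal w (toric_ideal A))"
    and x: "\<And>i. (\<Sum>j\<in>UNIV. of_int (A $ i $ j) * x $ j) = 0" "\<And>j. j \<notin> \<sigma> \<Longrightarrow> x $ j = 0"
  shows "x = 0"
proof -
  obtain D :: int and m where D: "D > 0" and m: "\<And>j. of_int D * x $ j = of_int (m j)"
    using common_denominator[of UNIV "\<lambda>j. x $ j"] by (auto simp: choice_iff)
  define z :: "int ^ 'n" where "z = (\<chi> j. m j)"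
  have "(A *v z) $ i = 0" for i
  proof -
    have "rat_of_int ((A *v z) $ i) = (\<Sum>j\<in>UNIV. of_int (A $ i $ j) * (of_int D * x $ j))"
      by (simp add: matrix_vector_mult_def z_def m)
    also have "\<dots> = of_int D * (\<Sum>j\<in>UNIV. of_int (A $ i $ j) * x $ j)"
      by (simp add: sum_distrib_left mult_ac)
    finally show ?thesis
      by (simp add: x)
  qed
  then have "A *v z = 0"
    by (simp add: vec_eq_iff)
  moreover have "z $ j = 0" if "j \<notin> \<sigma>" for j
    using m[of j] x(2)[OF that] by (simp add: z_def)
  ultimately have "z = 0"
    using standard_pair_int_kernel[OF M pair] by blast
  then have "of_int D * x $ j = 0" for j
    by (simp add: m vec_eq_iff z_def)
  then show ?thesis
    using D by (simp add: vec_eq_iff)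
qed

text \<open>Independence of the columns in \<open>\<sigma>\<close> in dual form: some rational
  combination of the rows agrees on \<open>\<sigma>\<close> with the unit vector at
  \<open>j\<close>.\<close>

lemma standard_pair_dual_rows:
  fixes A :: "int ^ 'n::finite ^ 'd::finite"
  assumes M: "monomial_ideal (initial_ideal w (toric_ideal A))"
    and pair: "(a, \<sigma>) \<in> standard_pairs (initial_ideal w (toric_ideal A))"
  shows "\<exists>b :: 'd \<Rightarrow> rat. \<forall>l\<in>\<sigma>. (\<Sum>i\<in>UNIV. b i * of_int (A $ i $ l)) = (if l = j then 1 else 0)"
proof -
  \<comment> \<open>Stack onto the matrix the unit rows outside \<open>\<sigma>\<close>; the result has trivial kernel.\<close>
  define N :: "rat ^ 'n ^ ('d + 'n)"
    where "N = (\<chi> r l. case r of Inl i \<Rightarrow> of_int (A $ i $ l)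
      | Inr k \<Rightarrow> if k = l \<and> k \<notin> \<sigma> then 1 else 0)"
  have "x = 0" if "N *v x = 0" for x
  proof (rule standard_pair_rat_kernel[OF M pair])
    have *: "(\<Sum>l\<in>UNIV. N $ r $ l * x $ l) = 0" for r
      using that by (simp add: vec_eq_iff matrix_vector_mult_def)
    show "(\<Sum>l\<in>UNIV. of_int (A $ i $ l) * x $ l) = 0" for i
      using *[of "Inl i"] by (simp add: N_def)
    show "x $ k = 0" if "k \<notin> \<sigma>" for k
      using *[of "Inr k"] that by (simp add: N_def if_distrib[of "\<lambda>y. y * _"] cong: if_cong)
  qed
  then obtain B :: "rat ^ ('d + 'n) ^ 'n" where B: "B ** N = mat 1"
    using matrix_left_invertible_ker[of N] by blast
  \<comment> \<open>Take row \<open>j\<close> of the left inverse and keep its entries at the rows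
    of \<open>A\<close>: on columns in \<open>\<sigma>\<close> the stacked unit rows vanish, so the
    other entries contribute nothing.\<close>
  show ?thesis
  proof (intro exI[of _ "\<lambda>i. B $ j $ Inl i"] ballI)
    fix l assume "l \<in> \<sigma>"
    have "(\<Sum>r\<in>UNIV. B $ j $ r * N $ r $ l) = (if l = j then 1 else 0)"
      using arg_cong[OF B, of "\<lambda>X. X $ j $ l"] by (auto simp: matrix_matrix_mult_def mat_def)
    moreover have "(\<Sum>r\<in>UNIV. B $ j $ r * N $ r $ l)
        = (\<Sum>i\<in>UNIV. B $ j $ Inl i * N $ Inl i $ l) + (\<Sum>k\<in>UNIV. B $ j $ Inr k * N $ Inr k $ l)"
      by (simp add: UNIV_Plus_UNIV[symmetric] sum.Plus del: UNIV_Plus_UNIV)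
    moreover have "N $ Inr k $ l = 0" for k
      using \<open>l \<in> \<sigma>\<close> by (auto simp: N_def)
    ultimately show "(\<Sum>i\<in>UNIV. B $ j $ Inl i * of_int (A $ i $ l)) = (if l = j then 1 else 0)"
      by (simp add: N_def)
  qed
qed

text \<open>The rational dual combination, read with complex coefficients, has coefficient 1 at
  \<open>j\<close> and 0 at the rest of \<open>\<sigma>\<close>, so only variables outside
  \<open>\<sigma>\<close> accompany \<open>var j\<close>.\<close>

lemma standard_pair_linear_form:
  fixes A :: "int ^ 'n::finite ^ 'd::finite"
  assumes M: "monomial_ideal (initial_ideal w (toric_ideal A))"
    and pair: "(a, \<sigma>) \<in> standard_pairs (initial_ideal w (toric_ideal A))" and j: "j \<in> \<sigma>"
  shows "\<exists>c. var j + (\<Sum>l\<in>- \<sigma>. cst (c l) * var l) \<in> Idl\<^bsub>poly_ring UNIV\<^esub> (range (row_form A))"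
proof -
  obtain b :: "'d \<Rightarrow> rat"
    where b: "\<forall>l\<in>\<sigma>. (\<Sum>i\<in>UNIV. b i * of_int (A $ i $ l)) = (if l = j then 1 else 0)"
    using standard_pair_dual_rows[OF M pair, of j] by blast
  define c where "c l = (of_rat (\<Sum>i\<in>UNIV. b i * of_int (A $ i $ l)) :: complex)" for l
  have "(\<Sum>i\<in>UNIV. cst (of_rat (b i)) * row_form A i) \<in> Idl\<^bsub>poly_ring UNIV\<^esub> (range (row_form A))"
    by (intro poly_ideal_sum[OF ideal_genideal_UNIV] poly_ideal_mult[OF ideal_genideal_UNIV]
        in_genideal_UNIV) simp_all
  moreover have "(\<Sum>i\<in>UNIV. cst (of_rat (b i)) * row_form A i) = (\<Sum>l\<in>UNIV. cst (c l) * var l)"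
    unfolding row_form_def sum_distrib_left c_def of_rat_sum cst_sum sum_distrib_right
    by (subst sum.swap) (simp add: cst_mult of_rat_mult mult_ac)
  moreover have "(\<Sum>l\<in>UNIV. cst (c l) * var l)
      = (\<Sum>l\<in>\<sigma>. cst (c l) * var l) + (\<Sum>l\<in>- \<sigma>. cst (c l) * var l)"
    using sum.subset_diff[of \<sigma> UNIV "\<lambda>l. cst (c l) * var l"]
    by (simp add: Compl_eq_Diff_UNIV add.commute)
  moreover have "(\<Sum>l\<in>\<sigma>. cst (c l) * var l) = (\<Sum>l\<in>\<sigma>. if l = j then var j else 0)"
    using b by (intro sum.cong) (auto simp: c_def)
  ultimately show ?thesis
    using j by auto
qed


section \<open>Elimination of the variables in the negative support\<close>

lemma linear_form_in_vars: "linear_form_in V p \<Longrightarrow> vars p \<subseteq> V"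
  unfolding linear_form_in_def by (elim exE ssubst) (intro vars_sum vars_mult, auto)

text \<open>
  Substituting \<open>L p\<close> for \<open>var (\<iota> p)\<close> kills the generators \<open>var (\<iota> p) - L p\<close> and fixes polynomials in
  the remaining variables.
\<close>

lemma eliminate_variables:
  fixes V :: "'n::finite set"
  assumes \<iota>: "bij_betw \<iota> S (- V)"
    and L: "\<And>p. p \<in> S \<Longrightarrow> linear_form_in V (L p)"
    and G: "\<And>g. g \<in> G \<Longrightarrow> linear_form_in V g"
    and h: "linear_form_in V h"
      "h \<in> Idl\<^bsub>poly_ring UNIV\<^esub> ((\<lambda>p. var (\<iota> p) - L p) ` S \<union> G)"
  shows "h \<in> Idl\<^bsub>poly_ring V\<^esub> G"
proof -
  define \<psi> where "\<psi> j = (if j \<in> V then var j else L (inv_into S \<iota> j))" for j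
  have fixed: "psubst \<psi> p = p" if p: "linear_form_in V p" for p
  proof -
    obtain c where "p = (\<Sum>j\<in>V. cst (c j) * var j)"
      using p unfolding linear_form_in_def by (elim exE)
    then show ?thesis
      by (simp add: psubst_linear_form \<psi>_def)
  qed
  have "vars (\<psi> j) \<subseteq> V" for j
    using \<iota> L inv_into_into[of j \<iota> S] by (auto simp: \<psi>_def bij_betw_def intro!: linear_form_in_vars)
  then have vars_\<psi>: "vars (psubst \<psi> p) \<subseteq> V" for p
    by (intro vars_psubst)
  have G_carrier: "G \<subseteq> carrier (poly_ring V)"
    using G linear_form_in_vars by auto
  have ideal_G: "ideal (Idl\<^bsub>poly_ring V\<^esub> G) (poly_ring V)"
    by (rule ring.genideal_ideal[OF ring_poly_ring G_carrier])
  \<comment> \<open>The preimage of the target ideal under the substitution. It is an ideal, so it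
    suffices to check the generators.\<close>
  let ?J = "{p. psubst \<psi> p \<in> Idl\<^bsub>poly_ring V\<^esub> G}"
  have "ideal ?J (poly_ring UNIV)"
    by (rule ideal_poly_ringI)
      (simp_all add: psubst_add psubst_mult vars_\<psi> poly_ideal_0[OF ideal_G]
        poly_ideal_add[OF ideal_G] poly_ideal_mult[OF ideal_G])
  moreover have "var (\<iota> p) - L p \<in> ?J" if "p \<in> S" for p
  proof -
    have "\<psi> (\<iota> p) = L p"
      using \<iota> that by (auto simp: \<psi>_def bij_betw_def)
    then show ?thesis
      using that by (simp add: psubst_diff psubst_var fixed[OF L] poly_ideal_0[OF ideal_G])
  qed
  moreover have "g \<in> ?J" if "g \<in> G" for g
    using that ring.genideal_self[OF ring_poly_ring G_carrier] by (auto simp: fixed[OF G])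
  ultimately have "Idl\<^bsub>poly_ring UNIV\<^esub> ((\<lambda>p. var (\<iota> p) - L p) ` S \<union> G) \<subseteq> ?J"
    by (intro ring.genideal_minimal[OF ring_poly_ring]) auto
  then show ?thesis
    using h fixed by auto
qed

theorem lemma4p5:
  fixes A :: "int ^ 'n::finite ^ 'd::finite"
    and \<beta> :: "complex ^ 'd"
    and w :: "real ^ 'n"
    and v :: "complex ^ 'n"
    and k :: nat
    and \<iota> :: "nat \<Rightarrow> 'n"
    and L \<ll> :: "nat \<Rightarrow> 'n mpol"
  assumes "rank (\<chi> i j. rat_of_int (A $ i $ j)) = CARD('d)"
    and "\<exists>H. affine_hyperplane H \<and> 0 \<notin> H \<and> (\<forall>j. (\<chi> i. rat_of_int (A $ i $ j)) \<in> H)"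
    and "generic_weight A w"
    and "fake_exponent A \<beta> w v"
    and "bij_betw \<iota> {1..k} (nsupp v)"
    and "\<forall>p\<in>{1..k}. linear_form_in (- nsupp v) (L p)"
    and "\<forall>q\<in>{1..CARD('d) - k}. linear_form_in (- nsupp v) (\<ll> q)"
    and "Idl\<^bsub>poly_ring UNIV\<^esub> (range (row_form A)) =
         Idl\<^bsub>poly_ring UNIV\<^esub> ((\<lambda>p. var (\<iota> p) - L p) ` {1..k} \<union> \<ll> ` {1..CARD('d) - k})"
  shows "sr_quotient_finite_dim (- nsupp v) (fake_link A w v)
           (Idl\<^bsub>sr_ring (- nsupp v) (fake_link A w v)\<^esub>
              (sr_class (- nsupp v) (fake_link A w v) ` \<ll> ` {1..CARD('d) - k}))"
proof (rule sr_quotient_finite_dimI)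
  let ?V = "- nsupp v" and ?G = "\<ll> ` {1..CARD('d) - k}"
  have G: "linear_form_in ?V g" if "g \<in> ?G" for g
    using that assms(7) by blast
  then show "vars g \<subseteq> ?V" if "g \<in> ?G" for g
    using that linear_form_in_vars by blast
  fix T j assume T: "T \<subseteq> ?V" "T \<in> fake_link A w v" and j: "j \<in> T"
  then obtain a \<sigma> where pair: "(a, \<sigma>) \<in> standard_pairs (initial_ideal w (toric_ideal A))"
    and \<sigma>: "T \<union> nsupp v \<subseteq> \<sigma>"
    by (auto simp: fake_link_def fake_complex_def standard_pairs_at_def)
  have M: "monomial_ideal (initial_ideal w (toric_ideal A))"
    using assms(3) by (simp add: generic_weight_def)
  obtain c where c: "var j + (\<Sum>l\<in>- \<sigma>. cst (c l) * var l)
      \<in> Idl\<^bsub>poly_ring UNIV\<^esub> (range (row_form A))"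
    using standard_pair_linear_form[OF M pair, of j] \<sigma> j by blast
  \<comment> \<open>Both \<open>T\<close> and the negative support lie in \<open>\<sigma>\<close>,
    so the tail involves only variables in \<open>?V - T\<close>; its coefficients are extended
    there by 0.\<close>
  define e where "e l = (if l \<in> - \<sigma> then c l else 0)" for l
  let ?h = "var j + (\<Sum>l\<in>?V - T. cst (e l) * var l)"
  have e: "(\<Sum>l\<in>- \<sigma>. cst (c l) * var l) = (\<Sum>l\<in>?V - T. cst (e l) * var l)"
    using \<sigma> by (intro sum.mono_neutral_cong_left) (auto simp: e_def)
  \<comment> \<open>The coefficients of \<open>?h\<close> as a single linear form over
    \<open>?V\<close>: 1 at \<open>j\<close>, 0 on the rest of \<open>T\<close>, and the tail
    elsewhere.\<close>
  define f where "f l = (if l \<in> T then if l = j then 1 else 0 else e l)" for l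
  have "(\<Sum>l\<in>T. cst (f l) * var l) = (\<Sum>l\<in>T. if l = j then var j else 0)"
    by (intro sum.cong) (auto simp: f_def)
  moreover have "(\<Sum>l\<in>?V - T. cst (f l) * var l) = (\<Sum>l\<in>?V - T. cst (e l) * var l)"
    by (intro sum.cong) (auto simp: f_def)
  ultimately have "?h = (\<Sum>l\<in>?V. cst (f l) * var l)"
    using sum.subset_diff[OF T(1), of "\<lambda>l. cst (f l) * var l"] j by (simp add: add.commute)
  then have h: "linear_form_in ?V ?h"
    unfolding linear_form_in_def by (rule exI[of _ f])
  have "bij_betw \<iota> {1..k} (- ?V)"
    using assms(5) by simp
  \<comment> \<open>The row ideal is exchanged for the row-reduced generators; since
    \<open>?h\<close> avoids the negative support, elimination leaves only the forms in
    \<open>?G\<close>.\<close>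
  then have "?h \<in> Idl\<^bsub>poly_ring ?V\<^esub> ?G"
    using bspec[OF assms(6)] G h c[unfolded e assms(8)] by (rule eliminate_variables)
  then show "\<exists>c. var j + (\<Sum>l\<in>?V - T. cst (c l) * var l) \<in> Idl\<^bsub>poly_ring ?V\<^esub> ?G"
    by (rule exI[of _ e])
qed

end
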